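(* Let $r\in(0,\infty)$, $1<p\leq q<\infty$, and $W\in\mathscr{A}^{\mathrm{loc}}_{p,q}(r)$. For any given cube $Q\subset\mathbb{R}^n$ with $\ell(Q)=r$, there exists $V\in\mathscr{A}_{p,q}$ satisfying $V=W$ on $Q$ and $$[V]_{\mathscr{A}_{p,q}}\leq 3^{n\gamma}\,[W]_{\mathscr{A}^{\mathrm{loc}}_{p,q}(r)},$$ where $\gamma:=1+\frac{q}{p'}$.
   Context: Cubes in $\mathbb{R}^n$ have edges parallel to the coordinate axes; $\ell(Q)$ is the edge length of $Q$; $\fint_Q f:=\frac1{|Q|}\int_Q f$; $p':=\frac{p}{p-1}$. Fix $m\in\mathbb{N}$; $\|A\|$ is the operator norm of a complex $m\times m$ matrix acting on $\mathbb{C}^m$ with the Euclidean norm. A matrix weight is a map $W$ from $\mathbb{R}^n$ to the positive semidefinite complex $m\times m$ matrices whose entries are locally integrable and such that $W(x)$ is positive definite for almost every $x$; $W^\alpha(x):=(W(x))^\alpha$ ($\alpha\in\mathbb{R}$) is defined a.e. by diagonalization. For $r\in(0,\infty)$ and $1<p\le q<\infty$, $\mathscr{A}^{\mathrm{loc}}_{p,q}(r)$ is the set of all matrix weights $W$ with $$[W]_{\mathscr{A}^{\mathrm{loc}}_{p,q}(r)}:=\sup_{\mathrm{cubes}\ Q:\ \ell(Q)\le r}\fint_Q\left[\fint_Q\left\|W^{\frac1q}(x)W^{-\frac1q}(y)\right\|^{p'}dy\right]^{\frac q{p'}}dx<\infty.$$ $\mathscr{A}_{p,q}$ and $[W]_{\mathscr{A}_{p,q}}$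 are defined in the same way with the supremum taken over all cubes $Q\subset\mathbb{R}^n$. *)

theory Defs
  imports "HOL-Analysis.Analysis"
begin

section \<open>Powers of positive semidefinite complex matrices\<close>

definition conj_transpose :: "complex^'m^'k \<Rightarrow> complex^'k^'m" where
  "conj_transpose A = map_matrix cnj (transpose A)"

definition hermitian :: "complex^'m^'m \<Rightarrow> bool" where
  "hermitian A \<longleftrightarrow> conj_transpose A = A"

definition unitary :: "complex^'m^'m \<Rightarrow> bool" where
  "unitary U \<longleftrightarrow> conj_transpose U ** U = mat 1 \<and> U ** conj_transpose U = mat 1"

definition quad_form :: "complex^'m^'m \<Rightarrow> complex^'m \<Rightarrow> complex" where
  "quad_form A z = (\<Sum>i\<in>UNIV. cnj (z $ i) * (A *v z) $ i)"

text \<open>For a Hermitian matrix the quadratic form is real-valued, so taking the real part only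
  changes the type.\<close>

definition pos_semidef :: "complex^'m^'m \<Rightarrow> bool" where
  "pos_semidef A \<longleftrightarrow> hermitian A \<and> (\<forall>z. 0 \<le> Re (quad_form A z))"

definition pos_def :: "complex^'m^'m \<Rightarrow> bool" where
  "pos_def A \<longleftrightarrow> hermitian A \<and> (\<forall>z. z \<noteq> 0 \<longrightarrow> 0 < Re (quad_form A z))"

definition real_diag :: "('m \<Rightarrow> real) \<Rightarrow> complex^'m^'m" where
  "real_diag d = (\<chi> i j. if i = j then complex_of_real (d i) else 0)"

text \<open>If \<open>A = U diag(d) U\<^sup>*\<close> with \<open>U\<close> unitary and \<open>d \<ge> 0\<close>, then \<open>A\<^sup>\<alpha> = U diag(d\<^sup>\<alpha>) U\<^sup>*\<close>; the lemma
  \<open>matrix_powr_diagonalization\<close> below shows that the choice of the diagonalization is irrelevant.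
  Since \<open>0 powr \<alpha> = 0\<close>, a singular positive semidefinite \<open>A\<close> is raised to the power \<open>\<alpha>\<close> on the
  orthogonal complement of its kernel; a matrix weight is singular only on a null set.\<close>

definition matrix_powr :: "complex^'m^'m \<Rightarrow> real \<Rightarrow> complex^'m^'m" where
  "matrix_powr A \<alpha> =
     (THE B. \<exists>U d. unitary U \<and> (\<forall>i. 0 \<le> d i) \<and>
        A = U ** real_diag d ** conj_transpose U \<and>
        B = U ** real_diag (\<lambda>i. d i powr \<alpha>) ** conj_transpose U)"

lemma real_diag_mult_right: "(M ** real_diag d) $ i $ j = M $ i $ j * complex_of_real (d j)"
  by (simp add: matrix_matrix_mult_def real_diag_def if_distrib sum.delta cong: if_cong)

lemma real_diag_mult_left: "(real_diag d ** M) $ i $ j = complex_of_real (d i) * M $ i $ j"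
  by (simp add: matrix_matrix_mult_def real_diag_def if_distrib if_distribR sum.delta cong: if_cong)

lemma unitary_diagonalization_fun_unique:
  assumes U: "unitary U" and V: "unitary V"
    and eq: "U ** real_diag d ** conj_transpose U = V ** real_diag e ** conj_transpose V"
  shows "U ** real_diag (\<lambda>i. f (d i)) ** conj_transpose U
       = V ** real_diag (\<lambda>i. f (e i)) ** conj_transpose V"
proof -
  let ?M = "conj_transpose V ** U"
  have "?M ** real_diag d = conj_transpose V ** (U ** real_diag d ** conj_transpose U) ** U"
    using U by (simp add: unitary_def matrix_mul_assoc [symmetric])
  also have "\<dots> = real_diag e ** ?M"
    unfolding eq using V by (simp add: unitary_def matrix_mul_assoc)
  finally have *: "?M ** real_diag d = real_diag e ** ?M" .
  have "?M $ i $ j * of_real (f (d j)) = of_real (f (e i)) * ?M $ i $ j" for i j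
  proof -
    have "?M $ i $ j * of_real (d j) = of_real (e i) * ?M $ i $ j"
      using * by (metis real_diag_mult_left real_diag_mult_right)
    then have "?M $ i $ j = 0 \<or> d j = e i"
      by (simp add: mult.commute)
    then show ?thesis by auto
  qed
  then have M: "?M ** real_diag (\<lambda>i. f (d i)) = real_diag (\<lambda>i. f (e i)) ** ?M"
    by (simp add: vec_eq_iff real_diag_mult_left real_diag_mult_right)
  have "U ** real_diag (\<lambda>i. f (d i)) ** conj_transpose U
      = V ** (?M ** real_diag (\<lambda>i. f (d i))) ** conj_transpose U"
    using V by (simp add: unitary_def matrix_mul_assoc)
  also have "\<dots> = V ** real_diag (\<lambda>i. f (e i)) ** conj_transpose V"
    unfolding M using U by (simp add: unitary_def matrix_mul_assoc [symmetric])
  finally show ?thesis .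
qed

lemma matrix_powr_diagonalization:
  assumes "unitary U" and "\<And>i. 0 \<le> d i" and "A = U ** real_diag d ** conj_transpose U"
  shows "matrix_powr A \<alpha> = U ** real_diag (\<lambda>i. d i powr \<alpha>) ** conj_transpose U"
  unfolding matrix_powr_def
proof (rule the_equality)
  fix B
  assume "\<exists>V e. unitary V \<and> (\<forall>i. 0 \<le> e i) \<and> A = V ** real_diag e ** conj_transpose V \<and>
    B = V ** real_diag (\<lambda>i. e i powr \<alpha>) ** conj_transpose V"
  then obtain V e where "unitary V" "A = V ** real_diag e ** conj_transpose V"
    "B = V ** real_diag (\<lambda>i. e i powr \<alpha>) ** conj_transpose V" by blast
  then show "B = U ** real_diag (\<lambda>i. d i powr \<alpha>) ** conj_transpose U"
    using unitary_diagonalization_fun_unique[of V U e d "\<lambda>t. t powr \<alpha>"] assms by simp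
qed (use assms in blast)

section \<open>Matrix weights\<close>

definition locally_integrable :: "(real^'n \<Rightarrow> complex) \<Rightarrow> bool" where
  "locally_integrable f \<longleftrightarrow> (\<forall>K. compact K \<longrightarrow> set_integrable lebesgue K f)"

definition matrix_weight :: "(real^'n \<Rightarrow> complex^'m^'m) \<Rightarrow> bool" where
  "matrix_weight W \<longleftrightarrow>
     (\<forall>x. pos_semidef (W x)) \<and>
     (\<forall>i j. locally_integrable (\<lambda>x. W x $ i $ j)) \<and>
     (AE x in lebesgue. pos_def (W x))"

section \<open>Cubes and averages\<close>

text \<open>\<open>is_cube Q l\<close>: \<open>Q\<close> is a cube with edges parallel to the axes and edge length \<open>l\<close>. Cubes are
  taken closed; averages do not see the boundary.\<close>

definition is_cube :: "(real^'n) set \<Rightarrow> real \<Rightarrow> bool" where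
  "is_cube Q l \<longleftrightarrow> 0 < l \<and> (\<exists>a. Q = cbox a (a + vec l))"

definition average :: "(real^'n) set \<Rightarrow> (real^'n \<Rightarrow> ennreal) \<Rightarrow> ennreal" where
  "average Q f = (\<integral>\<^sup>+x\<in>Q. f x \<partial>lebesgue) / emeasure lebesgue Q"

section \<open>Muckenhoupt characteristics\<close>

definition conj_exponent :: "real \<Rightarrow> real" where
  "conj_exponent p = p / (p - 1)"

text \<open>Real powers of extended nonnegative numbers, for exponents \<open>a > 0\<close>.\<close>

definition ennreal_powr :: "ennreal \<Rightarrow> real \<Rightarrow> ennreal" where
  "ennreal_powr x a = (if x = \<infinity> then \<infinity> else ennreal (enn2real x powr a))"

text \<open>The operator norm on \<open>\<complex>\<^sup>m\<close> with the Euclidean norm is \<^term>\<open>\<lambda>A. onorm ((*v) A)\<close>.\<close>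

definition A_char_on ::
  "(real^'n) set set \<Rightarrow> real \<Rightarrow> real \<Rightarrow> (real^'n \<Rightarrow> complex^'m^'m) \<Rightarrow> ennreal" where
  "A_char_on \<Q> p q W =
     (SUP Q\<in>\<Q>. average Q (\<lambda>x. ennreal_powr
        (average Q (\<lambda>y. ennreal
           (onorm ((*v) (matrix_powr (W x) (1 / q) ** matrix_powr (W y) (- 1 / q)))
              powr conj_exponent p)))
        (q / conj_exponent p)))"

definition A_loc_char :: "real \<Rightarrow> real \<Rightarrow> real \<Rightarrow> (real^'n \<Rightarrow> complex^'m^'m) \<Rightarrow> ennreal" where
  "A_loc_char p q r W = A_char_on {Q. \<exists>l\<le>r. is_cube Q l} p q W"

definition A_char :: "real \<Rightarrow> real \<Rightarrow> (real^'n \<Rightarrow> complex^'m^'m) \<Rightarrow> ennreal" where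
  "A_char p q W = A_char_on {Q. \<exists>l. is_cube Q l} p q W"

definition A_loc_class :: "real \<Rightarrow> real \<Rightarrow> real \<Rightarrow> (real^'n \<Rightarrow> complex^'m^'m) set" where
  "A_loc_class p q r = {W. matrix_weight W \<and> A_loc_char p q r W < \<infinity>}"

definition A_class :: "real \<Rightarrow> real \<Rightarrow> (real^'n \<Rightarrow> complex^'m^'m) set" where
  "A_class p q = {W. matrix_weight W \<and> A_char p q W < \<infinity>}"

end

theory Submission
  imports Defs
begin

text \<open>
  Let \<open>Q\<close> be the cube with lower corner \<open>a\<close> and edge length \<open>r\<close>. The weight is extended by repeated
  reflection: \<open>V = W \<circ> \<phi>\<close>, where \<open>\<phi>\<close> folds every coordinate into \<open>[a\<^sub>i, a\<^sub>i + r]\<close> by the even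
  \<open>2r\<close>-periodic zigzag function, so that \<open>\<phi>\<close> is the identity on \<open>Q\<close>. On each cell of the grid of
  translates of \<open>Q\<close> by \<open>r\<int>\<^sup>n\<close>, the map \<open>\<phi>\<close> is a composition of a translation with coordinate
  reflections, hence preserves Lebesgue measure; this makes \<open>V\<close> a matrix weight.

  The heart of the proof is \<open>average_fold_cube_le\<close>: for every cube \<open>R\<close> there is a cube \<open>S\<close> with edge
  length at most \<open>r\<close> such that the average of \<open>g \<circ> \<phi>\<close> over \<open>R\<close> is at most \<open>3\<^sup>n\<close> times the average
  of \<open>g\<close> over \<open>S\<close>, for all \<open>g \<ge> 0\<close> simultaneously. If \<open>l = \<ell>(R) \<ge> r\<close>, take \<open>S = Q\<close>: at most
  \<open>(l/r + 2)\<^sup>n \<le> (3l/r)\<^sup>n\<close> cells are needed to cover \<open>R\<close>. If \<open>l < r\<close>, at most \<open>3\<^sup>n\<close> cells are needed,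
  and \<open>\<phi>(R)\<close> lies in a cube \<open>S\<close> of edge length \<open>l\<close> because the zigzag function is \<open>1\<close>-Lipschitz.
  Applying this to the inner and then to the outer average in the characteristic of \<open>V\<close> produces
  the factors \<open>3\<^bsup>nq/p'\<^esup>\<close> and \<open>3\<^sup>n\<close>.

  The powers of \<open>W\<close> enter only through the pointwise values of the integrand, and their
  measurability is never needed: \<open>\<integral>\<^sup>+\<close> is a lower integral, and the few inequalities that the
  argument uses hold for lower integrals of arbitrary nonnegative functions.
\<close>

section \<open>Lower integrals\<close>

text \<open>The function \<open>f\<close> need not be measurable, here and in the rest of this section. In each case the
  corresponding fact for measurable functions is applied to a simple minorant.\<close>

lemma nn_integral_leI_simple:
  assumes "\<And>s. simple_function M s \<Longrightarrow> (\<And>x. s x \<le> f x) \<Longrightarrow> (\<integral>\<^sup>+x. s x \<partial>M) \<le> C"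
  shows "(\<integral>\<^sup>+x. f x \<partial>M) \<le> C"
  unfolding nn_integral_def[of M f]
  using assms by (auto intro!: SUP_least simp: le_fun_def nn_integral_eq_simple_integral[symmetric])

lemma nn_integral_measure_preserving_le:
  assumes S: "S \<in> measurable M M" "distr M M S = M" and inv: "\<And>x. T (S x) = x"
  shows "(\<integral>\<^sup>+x. f (T x) \<partial>M) \<le> (\<integral>\<^sup>+x. f x \<partial>M)"
proof (rule nn_integral_leI_simple)
  fix s assume s: "simple_function M s" and le: "\<And>x. s x \<le> f (T x)"
  have sm: "s \<in> borel_measurable M" using s by (rule borel_measurable_simple_function)
  have "(\<integral>\<^sup>+x. s x \<partial>M) = (\<integral>\<^sup>+x. s x \<partial>distr M M S)" by (simp add: S(2))
  also have "\<dots> = (\<integral>\<^sup>+x. s (S x) \<partial>M)" by (rule nn_integral_distr) (use S sm in auto)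
  also have "\<dots> \<le> (\<integral>\<^sup>+x. f x \<partial>M)"
    by (rule nn_integral_mono) (metis le inv)
  finally show "(\<integral>\<^sup>+x. s x \<partial>M) \<le> (\<integral>\<^sup>+x. f x \<partial>M)" .
qed

lemma nn_integral_finite_cover_le:
  assumes fin: "finite K" and A: "\<And>k. k \<in> K \<Longrightarrow> A k \<in> sets M" and cover: "B \<subseteq> (\<Union>k\<in>K. A k)"
  shows "(\<integral>\<^sup>+x\<in>B. f x \<partial>M) \<le> (\<Sum>k\<in>K. \<integral>\<^sup>+x\<in>B \<inter> A k. f x \<partial>M)"
proof (rule nn_integral_leI_simple)
  fix s assume s: "simple_function M s" and le: "\<And>x. s x \<le> f x * indicator B x"
  have sm: "s \<in> borel_measurable M" using s by (rule borel_measurable_simple_function)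
  have "s x \<le> (\<Sum>k\<in>K. s x * indicator (A k) x)" for x
  proof (cases "x \<in> B")
    case True
    then obtain k where k: "k \<in> K" "x \<in> A k" using cover by auto
    have "s x = s x * indicator (A k) x" using k by simp
    also have "\<dots> \<le> (\<Sum>k\<in>K. s x * indicator (A k) x)"
      by (rule member_le_sum) (use k fin in auto)
    finally show ?thesis .
  next
    case False
    then show ?thesis using le[of x] by simp
  qed
  then have "(\<integral>\<^sup>+x. s x \<partial>M) \<le> (\<integral>\<^sup>+x. (\<Sum>k\<in>K. s x * indicator (A k) x) \<partial>M)"
    by (intro nn_integral_mono)
  also have "\<dots> = (\<Sum>k\<in>K. \<integral>\<^sup>+x. s x * indicator (A k) x \<partial>M)"
    by (rule nn_integral_sum) (use sm A in auto)
  also have "\<dots> \<le> (\<Sum>k\<in>K. \<integral>\<^sup>+x\<in>B \<inter> A k. f x \<partial>M)"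
    by (intro sum_mono nn_integral_mono)
      (metis indicator_inter_arith le mult.assoc mult_right_mono zero_le)
  finally show "(\<integral>\<^sup>+x. s x \<partial>M) \<le> (\<Sum>k\<in>K. \<integral>\<^sup>+x\<in>B \<inter> A k. f x \<partial>M)" .
qed

lemma nn_integral_cmult_le:
  assumes "0 < c"
  shows "(\<integral>\<^sup>+x. ennreal c * f x \<partial>M) \<le> ennreal c * (\<integral>\<^sup>+x. f x \<partial>M)"
proof (rule nn_integral_leI_simple)
  fix s assume s: "simple_function M s" and le: "\<And>x. s x \<le> ennreal c * f x"
  have sm: "s \<in> borel_measurable M" using s by (rule borel_measurable_simple_function)
  \<comment> \<open>\<open>s / c\<close> is a simple minorant of \<open>f\<close>\<close>
  have cancel: "ennreal c * (ennreal (1 / c) * t) = t" "ennreal (1 / c) * (ennreal c * t) = t" for t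
    using assms by (simp_all add: mult.assoc[symmetric] flip: ennreal_mult)
  have "(\<integral>\<^sup>+x. s x \<partial>M) = ennreal c * (\<integral>\<^sup>+x. ennreal (1 / c) * s x \<partial>M)"
    using sm by (simp add: nn_integral_cmult cancel)
  also have "\<dots> \<le> ennreal c * (\<integral>\<^sup>+x. f x \<partial>M)"
    by (intro mult_left_mono nn_integral_mono) (metis cancel(2) le mult_left_mono zero_le, simp)
  finally show "(\<integral>\<^sup>+x. s x \<partial>M) \<le> ennreal c * (\<integral>\<^sup>+x. f x \<partial>M)" .
qed

section \<open>Averages and extended powers\<close>

lemma ennreal_powr_mono: "x \<le> y \<Longrightarrow> 0 < a \<Longrightarrow> ennreal_powr x a \<le> ennreal_powr y a"
  by (cases x; cases y) (auto simp: ennreal_powr_def top_unique intro!: powr_mono2)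

lemma ennreal_powr_cmult:
  assumes "0 < c" "0 < a"
  shows "ennreal_powr (ennreal c * x) a = ennreal (c powr a) * ennreal_powr x a"
  using assms
  by (cases x) (auto simp: ennreal_powr_def ennreal_mult_top ennreal_mult_eq_top_iff powr_mult
      simp flip: ennreal_mult)

lemma average_mono:
  assumes "\<And>x. f x \<le> g x"
  shows "average Q f \<le> average Q g"
  unfolding average_def
  by (intro divide_right_mono_ennreal nn_integral_mono mult_right_mono assms) simp

lemma average_cmult_le:
  assumes "0 < c"
  shows "average Q (\<lambda>x. ennreal c * f x) \<le> ennreal c * average Q f"
proof -
  have "(\<integral>\<^sup>+x\<in>Q. ennreal c * f x \<partial>lebesgue) \<le> ennreal c * (\<integral>\<^sup>+x\<in>Q. f x \<partial>lebesgue)"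
    using nn_integral_cmult_le[OF assms, of lebesgue "\<lambda>x. f x * indicator Q x"]
    by (simp add: mult.assoc)
  then show ?thesis
    unfolding average_def by (metis divide_right_mono_ennreal ennreal_times_divide)
qed

lemma emeasure_cube:
  fixes a :: "real^'n"
  assumes "0 \<le> l"
  shows "emeasure lebesgue (cbox a (a + vec l)) = ennreal (l ^ CARD('n))"
proof -
  have "measure lborel (cbox a (a + vec l)) = l ^ CARD('n)"
    using assms by (subst content_cbox_cart) (auto simp: interval_ne_empty_cart)
  moreover have "emeasure lebesgue (cbox a (a + vec l)) = emeasure lborel (cbox a (a + vec l))"
    by simp
  moreover have "emeasure lborel (cbox a (a + vec l)) = ennreal (measure lborel (cbox a (a + vec l)))"
    by (rule emeasure_eq_ennreal_measure)
      (use emeasure_lborel_cbox_finite[of a "a + vec l"] in auto)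
  ultimately show ?thesis by (simp only:)
qed

section \<open>Reflections of coordinates\<close>

text \<open>A translation composed with reflections of some of the coordinates, if all \<open>s i\<close> are \<open>\<plusminus>1\<close>.\<close>

definition sign_map :: "('n \<Rightarrow> real) \<Rightarrow> ('n \<Rightarrow> real) \<Rightarrow> real^'n \<Rightarrow> real^'n" where
  "sign_map s c x = (\<chi> i. c i + s i * x $ i)"

lemma sign_map_inverse:
  assumes "\<And>i. s i * s i = 1"
  shows "sign_map s c (sign_map s (\<lambda>i. - s i * c i) x) = x"
proof -
  have "c i + s i * (- s i * c i + s i * x $ i) = x $ i" for i
    using assms[of i] by algebra
  then show ?thesis by (simp add: sign_map_def vec_eq_iff)
qed

lemma sign_map_lebesgue:
  fixes s :: "'n::finite \<Rightarrow> real"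
  assumes s: "\<And>i. s i * s i = 1"
  shows "sign_map s c \<in> measurable lebesgue lebesgue"
    and "distr lebesgue lebesgue (sign_map s c) = lebesgue"
proof -
  have abs: "\<bar>s i\<bar> = 1" for i using s[of i] by (auto simp: square_eq_1_iff)
  let ?d = "\<lambda>j. (\<chi> i. s i) \<bullet> j"
  have d: "\<bar>?d j\<bar> = 1" if "j \<in> Basis" for j :: "real^'n"
    using that abs by (auto simp: Basis_vec_def inner_axis)
  have eq: "sign_map s c = (\<lambda>x. (\<chi> i. c i) + (\<Sum>j\<in>Basis. (?d j * (x \<bullet> j)) *\<^sub>R j))" (is "_ = ?T")
  proof (rule ext, rule euclidean_eqI)
    fix x b :: "real^'n" assume b: "b \<in> Basis"
    then obtain i where i: "b = axis i 1" by (auto simp: Basis_vec_def)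
    have "(\<Sum>j\<in>Basis. (?d j * (x \<bullet> j)) *\<^sub>R j) \<bullet> b = ?d b * (x \<bullet> b)"
      using b by (rule inner_sum_left_Basis)
    then show "sign_map s c x \<bullet> b = ?T x \<bullet> b"
      by (simp add: i sign_map_def inner_axis inner_add_left)
  qed
  have nz: "?d j \<noteq> 0" if "j \<in> Basis" for j :: "real^'n" using d[OF that] by auto
  show "sign_map s c \<in> measurable lebesgue lebesgue"
    unfolding eq by (rule lebesgue_affine_measurable) (use nz in auto)
  have "lebesgue = density (distr lebesgue lebesgue (sign_map s c)) (\<lambda>_. (\<Prod>j\<in>Basis. \<bar>?d j\<bar>))"
    unfolding eq by (rule lebesgue_affine_euclidean) (use nz in auto)
  also have "(\<Prod>j\<in>Basis. \<bar>?d j\<bar>) = 1" using d by (intro prod.neutral) auto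
  finally show "distr lebesgue lebesgue (sign_map s c) = lebesgue" by (simp add: density_1)
qed

section \<open>Folding Euclidean space onto a cube\<close>

text \<open>The zigzag function: the distance of \<open>t\<close> from the nearest integer multiple of \<open>2r\<close>.\<close>

definition fold_real :: "real \<Rightarrow> real \<Rightarrow> real" where
  "fold_real r t = \<bar>t - 2 * r * of_int (round (t / (2 * r)))\<bar>"

text \<open>The folding of \<open>\<real>\<^sup>n\<close> onto the cube with lower corner \<open>a\<close> and edge length \<open>r\<close>.\<close>

definition fold_cube :: "real^'n \<Rightarrow> real \<Rightarrow> real^'n \<Rightarrow> real^'n" where
  "fold_cube a r x = (\<chi> i. a $ i + fold_real r (x $ i - a $ i))"

text \<open>The closed cells of the grid generated by this cube, indexed by their position \<open>k\<close>.\<close>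

definition cell :: "real^'n \<Rightarrow> real \<Rightarrow> ('n \<Rightarrow> int) \<Rightarrow> (real^'n) set" where
  "cell a r k = cbox (\<chi> i. a $ i + of_int (k i) * r) (\<chi> i. a $ i + (of_int (k i) + 1) * r)"

text \<open>On the cell \<open>k\<close> the folding agrees with the affine map \<open>cell_map a r k\<close> below, which translates
  the coordinates with \<open>k i\<close> even and reflects those with \<open>k i\<close> odd.\<close>

definition cell_sign :: "('n \<Rightarrow> int) \<Rightarrow> 'n \<Rightarrow> real" where
  "cell_sign k i = (if even (k i) then 1 else - 1)"

definition cell_shift :: "real^'n \<Rightarrow> real \<Rightarrow> ('n \<Rightarrow> int) \<Rightarrow> 'n \<Rightarrow> real" where
  "cell_shift a r k i =
     (if even (k i) then - (of_int (k i) * r) else 2 * a $ i + (of_int (k i) + 1) * r)"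

definition cell_map :: "real^'n \<Rightarrow> real \<Rightarrow> ('n \<Rightarrow> int) \<Rightarrow> real^'n \<Rightarrow> real^'n" where
  "cell_map a r k = sign_map (cell_sign k) (cell_shift a r k)"

lemma cell_sign_square: "cell_sign k i * cell_sign k i = 1"
  by (simp add: cell_sign_def)

lemma cell_map_lebesgue:
  shows "cell_map a r k \<in> measurable lebesgue lebesgue"
    and "distr lebesgue lebesgue (cell_map a r k) = lebesgue"
  unfolding cell_map_def by (rule sign_map_lebesgue[OF cell_sign_square])+

lemma fold_real_le:
  assumes "0 < r"
  shows "fold_real r t \<le> \<bar>t - 2 * r * of_int j\<bar>"
proof -
  have scale: "\<bar>t - 2 * r * of_int i\<bar> = 2 * r * \<bar>t / (2 * r) - of_int i\<bar>" for i
  proof -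
    have "t - 2 * r * of_int i = 2 * r * (t / (2 * r) - of_int i)" using assms by (simp add: field_simps)
    then show ?thesis using assms by (simp add: abs_mult)
  qed
  show ?thesis
    unfolding fold_real_def scale
    using round_diff_minimal[of "t / (2 * r)" j] assms by (intro mult_left_mono) auto
qed

text \<open>Distinct multiples of \<open>2r\<close> are \<open>2r\<close> apart, so one within distance \<open>r\<close> of \<open>t\<close> is a nearest
  one.\<close>

lemma fold_real_eqI:
  assumes "0 < r" "\<bar>t - 2 * r * of_int j\<bar> \<le> r"
  shows "fold_real r t = \<bar>t - 2 * r * of_int j\<bar>"
proof (rule antisym[OF fold_real_le[OF assms(1)]])
  let ?i = "round (t / (2 * r))"
  show "\<bar>t - 2 * r * of_int j\<bar> \<le> fold_real r t"
  proof (cases "?i = j")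
    case True then show ?thesis by (simp add: fold_real_def)
  next
    case False
    then have "1 \<le> \<bar>real_of_int (?i - j)\<bar>" by linarith
    then have "2 * r \<le> 2 * r * \<bar>real_of_int (?i - j)\<bar>" using assms(1) by simp
    also have "\<dots> = \<bar>2 * r * of_int ?i - 2 * r * of_int j\<bar>"
      using assms(1) by (simp add: abs_mult flip: right_diff_distrib)
    finally show ?thesis using assms(2) unfolding fold_real_def by linarith
  qed
qed

lemma fold_real_lipschitz:
  assumes "0 < r"
  shows "fold_real r t \<le> fold_real r u + \<bar>t - u\<bar>"
  using fold_real_le[OF assms, of t "round (u / (2 * r))"] unfolding fold_real_def[of r u] by linarith

lemma fold_real_cell:
  assumes r: "0 < r" and t: "of_int k * r \<le> t" "t \<le> (of_int k + 1) * r"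
  shows "fold_real r t = (if even k then t - of_int k * r else (of_int k + 1) * r - t)"
proof (cases "even k")
  case True
  then obtain j where j: "k = 2 * j" by (elim evenE)
  show ?thesis using fold_real_eqI[OF r, of t j] t True by (simp add: j algebra_simps)
next
  case False
  then obtain j where j: "k = 2 * j + 1" by (elim oddE)
  show ?thesis using fold_real_eqI[OF r, of t "j + 1"] t False by (simp add: j algebra_simps)
qed

lemma fold_cube_eq_cell_map:
  assumes "0 < r" "x \<in> cell a r k"
  shows "fold_cube a r x = cell_map a r k x"
proof -
  have "fold_real r (x $ i - a $ i) = (if even (k i) then x $ i - a $ i - of_int (k i) * r
      else (of_int (k i) + 1) * r - (x $ i - a $ i))" for i
    by (rule fold_real_cell) (use assms in \<open>auto simp: cell_def mem_box_cart algebra_simps\<close>)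
  then show ?thesis
    by (simp add: fold_cube_def cell_map_def sign_map_def cell_sign_def cell_shift_def vec_eq_iff)
qed

lemma mem_cell_floor:
  assumes "0 < r"
  shows "x \<in> cell a r (\<lambda>i. \<lfloor>(x $ i - a $ i) / r\<rfloor>)"
proof -
  have "of_int \<lfloor>t / r\<rfloor> * r \<le> t" "t \<le> (of_int \<lfloor>t / r\<rfloor> + 1) * r" for t
  proof -
    have "of_int \<lfloor>t / r\<rfloor> \<le> t / r" "t / r \<le> of_int \<lfloor>t / r\<rfloor> + 1" by linarith+
    then show "of_int \<lfloor>t / r\<rfloor> * r \<le> t" "t \<le> (of_int \<lfloor>t / r\<rfloor> + 1) * r"
      using assms by (simp_all only: pos_le_divide_eq pos_divide_le_eq)
  qed
  from this[of "x $ i - a $ i" for i] show ?thesis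
    by (simp add: cell_def mem_box_cart) (smt (verit))
qed

lemma fold_cube_in_cube:
  assumes "0 < r"
  shows "fold_cube a r x \<in> cbox a (a + vec r)"
proof -
  have "fold_real r t \<le> r" for t
  proof -
    have "\<bar>t / (2 * r) - of_int (round (t / (2 * r)))\<bar> \<le> 1 / 2"
      using of_int_round_abs_le[of "t / (2 * r)"] by (simp add: abs_minus_commute)
    then have "2 * r * \<bar>t / (2 * r) - of_int (round (t / (2 * r)))\<bar> \<le> r" using assms by simp
    also have "2 * r * \<bar>t / (2 * r) - of_int (round (t / (2 * r)))\<bar> = fold_real r t"
    proof -
      have "t - 2 * r * u = 2 * r * (t / (2 * r) - u)" for u using assms by (simp add: field_simps)
      then show ?thesis using assms by (simp add: fold_real_def abs_mult)
    qed
    finally show ?thesis .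
  qed
  then show ?thesis by (auto simp: fold_cube_def mem_box_cart fold_real_def)
qed

lemma fold_cube_id:
  assumes "0 < r" "x \<in> cbox a (a + vec r)"
  shows "fold_cube a r x = x"
  using fold_cube_eq_cell_map[OF assms(1), of x a "\<lambda>_. 0"] assms(2)
  by (simp add: cell_def mem_box_cart cell_map_def sign_map_def cell_sign_def cell_shift_def vec_eq_iff)

text \<open>The indices of finitely many cells that cover the cube with lower corner \<open>b\<close> and edge length \<open>l\<close>.
  Functions on the whole finite type \<open>'n\<close> have no argument outside the domain, so the extensional
  product is the set of all functions with values in the given integer intervals.\<close>

definition cells_near :: "real^'n \<Rightarrow> real \<Rightarrow> real^'n \<Rightarrow> real \<Rightarrow> ('n \<Rightarrow> int) set" where
  "cells_near a r b l =
     (\<Pi>\<^sub>E i\<in>UNIV. {\<lfloor>(b $ i - a $ i) / r\<rfloor>..\<lfloor>(b $ i - a $ i + l) / r\<rfloor>})"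

lemma finite_cells_near: "finite (cells_near a r b l)"
  unfolding cells_near_def by (rule finite_PiE) auto

lemma cells_near_cover:
  assumes "0 < r"
  shows "cbox b (b + vec l) \<subseteq> (\<Union>k\<in>cells_near a r b l. cell a r k)"
proof
  fix x assume x: "x \<in> cbox b (b + vec l)"
  have "(\<lambda>i. \<lfloor>(x $ i - a $ i) / r\<rfloor>) \<in> cells_near a r b l"
    using x assms
    by (fastforce simp: cells_near_def mem_box_cart intro!: floor_mono divide_right_mono)
  then show "x \<in> (\<Union>k\<in>cells_near a r b l. cell a r k)"
    using mem_cell_floor[OF assms, of x a] by blast
qed

lemma card_cells_near_le:
  fixes a b :: "real^'n"
  assumes "\<And>u. of_int (\<lfloor>(u + l) / r\<rfloor> - \<lfloor>u / r\<rfloor> + 1) \<le> N" "0 \<le> N"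
  shows "real (card (cells_near a r b l)) \<le> N ^ CARD('n)"
proof -
  have "real (card (cells_near a r b l)) =
      (\<Prod>i\<in>UNIV. real (card {\<lfloor>(b $ i - a $ i) / r\<rfloor>..\<lfloor>(b $ i - a $ i + l) / r\<rfloor>}))"
    unfolding cells_near_def by (subst card_PiE) auto
  also have "\<dots> \<le> (\<Prod>i\<in>(UNIV::'n set). N)"
  proof (rule prod_mono, intro conjI)
    fix i
    show "real (card {\<lfloor>(b $ i - a $ i) / r\<rfloor>..\<lfloor>(b $ i - a $ i + l) / r\<rfloor>}) \<le> N"
      using assms(1)[of "b $ i - a $ i"] assms(2) by simp
  qed simp
  finally show ?thesis by simp
qed

text \<open>On each of the cells that cover the cube, the folding is an injective measure-preserving map
  into \<open>S\<close>, so each of them contributes at most the integral over \<open>S\<close>.\<close>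

lemma integral_fold_cube_le:
  assumes r: "0 < r" and S: "fold_cube a r ` cbox b (b + vec l) \<subseteq> S"
  shows "(\<integral>\<^sup>+x\<in>cbox b (b + vec l). g (fold_cube a r x) \<partial>lebesgue)
       \<le> of_nat (card (cells_near a r b l)) * (\<integral>\<^sup>+x\<in>S. g x \<partial>lebesgue)"
proof -
  let ?R = "cbox b (b + vec l)"
  have "(\<integral>\<^sup>+x\<in>?R. g (fold_cube a r x) \<partial>lebesgue)
      \<le> (\<Sum>k\<in>cells_near a r b l. \<integral>\<^sup>+x\<in>?R \<inter> cell a r k. g (fold_cube a r x) \<partial>lebesgue)"
    by (rule nn_integral_finite_cover_le[OF finite_cells_near _ cells_near_cover[OF r]])
      (simp add: cell_def)
  also have "\<dots> \<le> (\<Sum>k\<in>cells_near a r b l. \<integral>\<^sup>+x\<in>S. g x \<partial>lebesgue)"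
  proof (rule sum_mono)
    fix k
    have "(\<integral>\<^sup>+x\<in>?R \<inter> cell a r k. g (fold_cube a r x) \<partial>lebesgue)
        \<le> (\<integral>\<^sup>+x. g (cell_map a r k x) * indicator S (cell_map a r k x) \<partial>lebesgue)"
    proof (rule nn_integral_mono)
      fix x
      show "g (fold_cube a r x) * indicator (?R \<inter> cell a r k) x
          \<le> g (cell_map a r k x) * indicator S (cell_map a r k x)"
        using S fold_cube_eq_cell_map[OF r, of x a k] by (auto simp: indicator_def)
    qed
    also have "\<dots> \<le> (\<integral>\<^sup>+x\<in>S. g x \<partial>lebesgue)"
      using nn_integral_measure_preserving_le[OF sign_map_lebesgue[OF cell_sign_square]
          sign_map_inverse[OF cell_sign_square], where f="\<lambda>x. g x * indicator S x"]
      unfolding cell_map_def .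
    finally show "(\<integral>\<^sup>+x\<in>?R \<inter> cell a r k. g (fold_cube a r x) \<partial>lebesgue) \<le> (\<integral>\<^sup>+x\<in>S. g x \<partial>lebesgue)" .
  qed
  finally show ?thesis by simp
qed

text \<open>The last assumption says that the number of cells needed in each coordinate direction is at most
  \<open>3l/m\<close>; the factor \<open>(l/m)\<^sup>n\<close> is absorbed by the ratio of the volumes of the two cubes.\<close>

lemma average_fold_cube_le_of_count:
  fixes a b c :: "real^'n"
  assumes r: "0 < r" and l: "0 < l" and m: "0 < m"
    and S: "fold_cube a r ` cbox b (b + vec l) \<subseteq> cbox c (c + vec m)"
    and N: "\<And>u. of_int (\<lfloor>(u + l) / r\<rfloor> - \<lfloor>u / r\<rfloor> + 1) * m \<le> 3 * l"
  shows "average (cbox b (b + vec l)) (\<lambda>x. g (fold_cube a r x))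
       \<le> ennreal (3 ^ CARD('n)) * average (cbox c (c + vec m)) g"
proof -
  let ?n = "CARD('n)" and ?k = "real (card (cells_near a r b l))"
  let ?I = "\<integral>\<^sup>+x\<in>cbox c (c + vec m). g x \<partial>lebesgue"
  have "?k \<le> (3 * l / m) ^ ?n"
    by (rule card_cells_near_le) (use N l m in \<open>auto simp: pos_le_divide_eq\<close>)
  then have "?k / l ^ ?n \<le> (3 * l / m) ^ ?n / l ^ ?n"
    using l by (intro divide_right_mono) auto
  also have "\<dots> = 3 ^ ?n / m ^ ?n" using l by (simp add: power_divide power_mult_distrib)
  finally have k: "?k / l ^ ?n \<le> 3 ^ ?n / m ^ ?n" .
  have split: "ennreal (s / t) * I = ennreal s * I / ennreal t" if "0 \<le> s" "0 < t" for s t I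
    using that by (metis divide_ennreal ennreal_divide_times ennreal_times_divide)
  have "average (cbox b (b + vec l)) (\<lambda>x. g (fold_cube a r x)) \<le> ennreal ?k * ?I / ennreal (l ^ ?n)"
    unfolding average_def emeasure_cube[OF less_imp_le[OF l]]
    using integral_fold_cube_le[OF r S, of g]
    by (intro divide_right_mono_ennreal) (simp add: ennreal_of_nat_eq_real_of_nat)
  also have "\<dots> = ennreal (?k / l ^ ?n) * ?I" using l by (subst split) auto
  also have "\<dots> \<le> ennreal (3 ^ ?n / m ^ ?n) * ?I" by (intro mult_right_mono ennreal_leI k) simp
  also have "\<dots> = ennreal (3 ^ ?n) * average (cbox c (c + vec m)) g"
    unfolding average_def emeasure_cube[OF less_imp_le[OF m]]
    using m by (subst split) (auto simp: ennreal_times_divide)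
  finally show ?thesis .
qed

lemma average_fold_cube_le:
  fixes a :: "real^'n"
  assumes r: "0 < r" and R: "is_cube R l"
  obtains S m where "is_cube S m" "m \<le> r"
    "\<And>g. average R (\<lambda>x. g (fold_cube a r x)) \<le> ennreal (3 ^ CARD('n)) * average S g"
proof -
  obtain b where l: "0 < l" and Rb: "R = cbox b (b + vec l)" using R by (auto simp: is_cube_def)
  have fl: "of_int (\<lfloor>(u + l) / r\<rfloor> - \<lfloor>u / r\<rfloor> + 1) < l / r + 2" for u :: real
    unfolding add_divide_distrib using l r by linarith
  show ?thesis
  proof (cases "r \<le> l")
    case True
    have N: "of_int (\<lfloor>(u + l) / r\<rfloor> - \<lfloor>u / r\<rfloor> + 1) * r \<le> 3 * l" for u
    proof -
      have "of_int (\<lfloor>(u + l) / r\<rfloor> - \<lfloor>u / r\<rfloor> + 1) * r \<le> (l / r + 2) * r"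
        using fl[of u] r by (intro mult_right_mono) auto
      also have "\<dots> = l + 2 * r" using r by (simp add: field_simps)
      finally show ?thesis using True by linarith
    qed
    show ?thesis
    proof (rule that[of "cbox a (a + vec r)" r])
      show "is_cube (cbox a (a + vec r)) r" using r by (auto simp: is_cube_def)
      show "average R (\<lambda>x. g (fold_cube a r x))
          \<le> ennreal (3 ^ CARD('n)) * average (cbox a (a + vec r)) g" for g
        unfolding Rb using fold_cube_in_cube[OF r] by (intro average_fold_cube_le_of_count r l N) auto
    qed simp
  next
    case False
    have N: "of_int (\<lfloor>(u + l) / r\<rfloor> - \<lfloor>u / r\<rfloor> + 1) * l \<le> 3 * l" for u
    proof -
      have "l / r < 1" using False r by simp
      then have "real_of_int (\<lfloor>(u + l) / r\<rfloor> - \<lfloor>u / r\<rfloor> + 1) \<le> 3" using fl[of u] by linarith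
      then show ?thesis using l by simp
    qed
    \<comment> \<open>each folded edge of \<open>R\<close> has diameter at most \<open>l\<close>, so it fits above its infimum\<close>
    define c :: "real^'n" where
      "c = (\<chi> i. a $ i + (INF t\<in>{b $ i..b $ i + l}. fold_real r (t - a $ i)))"
    have sub: "fold_cube a r ` R \<subseteq> cbox c (c + vec l)"
    proof clarify
      fix x assume x: "x \<in> R"
      have "(INF t\<in>{b $ i..b $ i + l}. fold_real r (t - a $ i)) \<le> fold_real r (x $ i - a $ i)"
        and "fold_real r (x $ i - a $ i) - l \<le> (INF t\<in>{b $ i..b $ i + l}. fold_real r (t - a $ i))" for i
      proof -
        have xi: "x $ i \<in> {b $ i..b $ i + l}" using x by (auto simp: Rb mem_box_cart)
        show "(INF t\<in>{b $ i..b $ i + l}. fold_real r (t - a $ i)) \<le> fold_real r (x $ i - a $ i)"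
          by (rule cINF_lower[OF _ xi]) (auto intro!: bdd_belowI2[of _ 0] simp: fold_real_def)
        show "fold_real r (x $ i - a $ i) - l \<le> (INF t\<in>{b $ i..b $ i + l}. fold_real r (t - a $ i))"
        proof (rule cINF_greatest)
          fix t assume "t \<in> {b $ i..b $ i + l}"
          then show "fold_real r (x $ i - a $ i) - l \<le> fold_real r (t - a $ i)"
            using xi fold_real_lipschitz[OF r, of "x $ i - a $ i" "t - a $ i"] by auto
        qed (use l in auto)
      qed
      then show "fold_cube a r x \<in> cbox c (c + vec l)"
        by (simp add: mem_box_cart fold_cube_def c_def) (smt (verit))
    qed
    show ?thesis
    proof (rule that[of "cbox c (c + vec l)" l])
      show "is_cube (cbox c (c + vec l)) l" using l by (auto simp: is_cube_def)
      show "average R (\<lambda>x. g (fold_cube a r x))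
          \<le> ennreal (3 ^ CARD('n)) * average (cbox c (c + vec l)) g" for g
        unfolding Rb using sub[unfolded Rb] by (intro average_fold_cube_le_of_count r l N)
    qed (use False in simp)
  qed
qed

section \<open>The folded weight\<close>

lemma locally_integrable_fold_cube:
  fixes f :: "real^'n \<Rightarrow> complex"
  assumes r: "0 < r" and f: "locally_integrable f"
  shows "locally_integrable (\<lambda>x. f (fold_cube a r x))"
  unfolding locally_integrable_def
proof (intro allI impI)
  fix K :: "(real^'n) set" assume K: "compact K"
  let ?Q = "cbox a (a + vec r)"
  have cell: "set_integrable lebesgue (cell a r k) (\<lambda>x. f (fold_cube a r x))" for k
  proof -
    let ?T = "cell_map a r k"
    have "set_integrable lebesgue ?Q f" using f by (auto simp: locally_integrable_def)
    then have "integrable (distr lebesgue lebesgue ?T) (\<lambda>x. indicator ?Q x *\<^sub>R f x)"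
      by (simp add: cell_map_lebesgue set_integrable_def)
    then have "integrable lebesgue (\<lambda>x. indicator ?Q (?T x) *\<^sub>R f (?T x))"
      by (rule integrable_distr[OF cell_map_lebesgue(1)])
    then have "set_integrable lebesgue (?T -` ?Q) (\<lambda>x. f (?T x))"
      by (simp add: set_integrable_def indicator_def vimage_def)
    moreover have "cell a r k \<subseteq> ?T -` ?Q"
      using fold_cube_eq_cell_map[OF r, of _ a k] fold_cube_in_cube[OF r, of a]
      by (metis subsetI vimageI2)
    ultimately have "set_integrable lebesgue (cell a r k) (\<lambda>x. f (?T x))"
      by (intro set_integrable_subset[of lebesgue "?T -` ?Q" _ "cell a r k"])
        (simp_all add: cell_def)
    moreover have "(\<lambda>x. indicator (cell a r k) x *\<^sub>R f (?T x)) =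
        (\<lambda>x. indicator (cell a r k) x *\<^sub>R f (fold_cube a r x))"
      using fold_cube_eq_cell_map[OF r, of _ a k] by (auto simp: indicator_def fun_eq_iff)
    ultimately show ?thesis by (simp add: set_integrable_def)
  qed
  obtain B where B: "\<And>x. x \<in> K \<Longrightarrow> norm x \<le> B" using compact_imp_bounded[OF K] by (auto simp: bounded_iff)
  define b :: "real^'n" where "b = vec (- \<bar>B\<bar>)"
  have "K \<subseteq> cbox b (b + vec (2 * \<bar>B\<bar>))"
  proof
    fix x assume "x \<in> K"
    then have "\<bar>x $ i\<bar> \<le> B" for i using B component_le_norm_cart order_trans by blast
    then show "x \<in> cbox b (b + vec (2 * \<bar>B\<bar>))"
      by (simp add: mem_box_cart b_def) (smt (verit))
  qed
  then have sub: "K \<subseteq> (\<Union>k\<in>cells_near a r b (2 * \<bar>B\<bar>). cell a r k)"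
    using cells_near_cover[OF r] by blast
  have "set_integrable lebesgue (\<Union>k\<in>cells_near a r b (2 * \<bar>B\<bar>). cell a r k)
      (\<lambda>x. f (fold_cube a r x))"
    by (rule set_integrable_UN[OF finite_cells_near cell]) (simp add: cell_def)
  then show "set_integrable lebesgue K (\<lambda>x. f (fold_cube a r x))"
    by (rule set_integrable_subset[OF _ fmeasurableD[OF lmeasurable_compact[OF K]] sub])
qed

text \<open>The folding agrees everywhere with one of countably many maps under which null sets have null
  preimages.\<close>

lemma AE_fold_cube:
  fixes P :: "real^'n \<Rightarrow> bool"
  assumes r: "0 < r" and P: "AE x in lebesgue. P x"
  shows "AE x in lebesgue. P (fold_cube a r x)"
proof -
  have "AE x in lebesgue. P (cell_map a r k x)" for k
    by (rule AE_distrD[OF cell_map_lebesgue(1)]) (subst cell_map_lebesgue(2), rule P)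
  then have "AE x in lebesgue. \<forall>k. P (cell_map a r k x)" by (simp add: AE_all_countable)
  then show ?thesis
  proof (rule AE_mp, intro AE_I2 impI)
    fix x assume "\<forall>k. P (cell_map a r k x)"
    then show "P (fold_cube a r x)"
      using fold_cube_eq_cell_map[OF r mem_cell_floor[OF r]] by metis
  qed
qed

lemma matrix_weight_fold_cube:
  fixes W :: "real^'n \<Rightarrow> complex^'m^'m"
  assumes "0 < r" "matrix_weight W"
  shows "matrix_weight (\<lambda>x. W (fold_cube a r x))"
  unfolding matrix_weight_def
proof (intro conjI allI)
  show "pos_semidef (W (fold_cube a r x))" for x
    using assms(2) by (simp add: matrix_weight_def)
  show "locally_integrable (\<lambda>x. W (fold_cube a r x) $ i $ j)" for i j
    using assms by (intro locally_integrable_fold_cube) (simp_all add: matrix_weight_def)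
  show "AE x in lebesgue. pos_def (W (fold_cube a r x))"
    using assms by (intro AE_fold_cube) (simp_all add: matrix_weight_def)
qed

lemma A_char_fold_cube_le:
  fixes W :: "real^'n \<Rightarrow> complex^'m^'m"
  assumes r: "0 < r" and s: "0 < q / conj_exponent p"
  shows "A_char p q (\<lambda>x. W (fold_cube a r x))
    \<le> ennreal (3 powr (real CARD('n) * (1 + q / conj_exponent p))) * A_loc_char p q r W"
  unfolding A_char_def A_char_on_def[of "{Q. \<exists>l. is_cube Q l}"]
proof (rule SUP_least, clarify)
  fix R :: "(real^'n) set" and l assume R: "is_cube R l"
  obtain S m where S: "is_cube S m" "m \<le> r"
    and avg: "\<And>g. average R (\<lambda>x. g (fold_cube a r x)) \<le> ennreal (3 ^ CARD('n)) * average S g"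
    by (rule average_fold_cube_le[OF r R, where a=a]) (rule that)
  let ?\<phi> = "fold_cube a r" and ?s = "q / conj_exponent p" and ?C = "3 ^ CARD('n) :: real"
  define F where "F x y = ennreal
     (onorm ((*v) (matrix_powr (W x) (1 / q) ** matrix_powr (W y) (- 1 / q))) powr conj_exponent p)" for x y
  let ?H = "\<lambda>x. ennreal_powr (average S (F x)) ?s"
  have "average R (\<lambda>x. ennreal_powr (average R (\<lambda>y. F (?\<phi> x) (?\<phi> y))) ?s)
      \<le> average R (\<lambda>x. ennreal (?C powr ?s) * ?H (?\<phi> x))"
  proof (rule average_mono)
    fix x
    have "ennreal_powr (average R (\<lambda>y. F (?\<phi> x) (?\<phi> y))) ?s
        \<le> ennreal_powr (ennreal ?C * average S (F (?\<phi> x))) ?s"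
      by (rule ennreal_powr_mono[OF avg s])
    also have "\<dots> = ennreal (?C powr ?s) * ?H (?\<phi> x)" by (rule ennreal_powr_cmult) (use s in auto)
    finally show "ennreal_powr (average R (\<lambda>y. F (?\<phi> x) (?\<phi> y))) ?s
        \<le> ennreal (?C powr ?s) * ?H (?\<phi> x)" .
  qed
  also have "\<dots> \<le> ennreal (?C powr ?s) * average R (\<lambda>x. ?H (?\<phi> x))"
    by (rule average_cmult_le) simp
  also have "\<dots> \<le> ennreal (?C powr ?s) * (ennreal ?C * average S ?H)"
    by (intro mult_left_mono avg) simp
  also have "\<dots> = ennreal (3 powr (real CARD('n) * (1 + ?s))) * average S ?H"
  proof -
    have "?C powr ?s * ?C = 3 powr (real CARD('n) * (1 + ?s))"
      by (simp add: powr_powr powr_add distrib_left flip: powr_realpow)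
    then show ?thesis by (simp add: mult.assoc[symmetric] flip: ennreal_mult)
  qed
  also have "\<dots> \<le> ennreal (3 powr (real CARD('n) * (1 + ?s))) * A_loc_char p q r W"
    unfolding A_loc_char_def A_char_on_def F_def using S by (intro mult_left_mono SUP_upper) auto
  finally show "average R (\<lambda>x. ennreal_powr (average R (\<lambda>y. ennreal
       (onorm ((*v) (matrix_powr (W (?\<phi> x)) (1 / q) ** matrix_powr (W (?\<phi> y)) (- 1 / q)))
          powr conj_exponent p))) ?s)
     \<le> ennreal (3 powr (real CARD('n) * (1 + ?s))) * A_loc_char p q r W"
    unfolding F_def .
qed

theorem theorem3p1:
  fixes r p q :: real
    and W :: "real^'n \<Rightarrow> complex^'m^'m"
    and Q :: "(real^'n) set"
  assumes "0 < r" and "1 < p" and "p \<le> q"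
    and "W \<in> A_loc_class p q r"
    and "is_cube Q r"
  shows "\<exists>V \<in> A_class p q.
           (\<forall>x\<in>Q. V x = W x) \<and>
           A_char p q V
             \<le> ennreal (3 powr (real CARD('n) * (1 + q / conj_exponent p))) * A_loc_char p q r W"
proof -
  obtain a where Q: "Q = cbox a (a + vec r)" using assms(5) by (auto simp: is_cube_def)
  have W: "matrix_weight W" "A_loc_char p q r W < \<infinity>" using assms(4) by (auto simp: A_loc_class_def)
  have "0 < q / conj_exponent p" using assms by (simp add: conj_exponent_def)
  note le = A_char_fold_cube_le[OF assms(1) this, of W a]
  have "A_char p q (\<lambda>x. W (fold_cube a r x)) < \<infinity>"
    by (rule le_less_trans[OF le]) (use W(2) in \<open>simp add: ennreal_mult_less_top\<close>)
  then show ?thesis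
    using le matrix_weight_fold_cube[OF assms(1) W(1)]
    by (intro bexI[of _ "\<lambda>x. W (fold_cube a r x)"])
      (simp_all add: A_class_def Q fold_cube_id[OF assms(1)])
qed

end
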